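(* The Assouad spectra of the popcorn graph $G_f$ and the full popcorn set $F$ are given by $$\dim_A^\theta G_f=\dim_A^\theta F=\begin{cases}\dfrac{\frac43-\theta}{1-\theta} & \text{if } \theta\in(0,\tfrac23),\\[2mm] 2 & \text{if } \theta\in[\tfrac23,1).\end{cases}$$
   Context: The popcorn function $f:[0,1]\to\mathbb{R}$ is defined by $f(x)=1/q$ if $x=p/q$ with $\gcd(p,q)=1$ and $1\le p<q$ integers, and $f(x)=0$ otherwise. The popcorn graph is $G_f=\{(x,f(x)) : x\in[0,1]\}\subset\mathbb{R}^2$. The full popcorn set is $F=\{(p/q,1/q): p,q \text{ positive integers with } p<q\}\cup([0,1]\times\{0\})$. For a bounded set $X\subset\mathbb{R}^d$ and $\delta>0$, $N_\delta(X)$ denotes the smallest number of closed cubes of side length $\delta$ needed to cover $X$ (with $N_\delta(\emptyset)=0$). For $x=(x_1,\dots,x_d)\in\mathbb{R}^d$ and $R>0$ write $C(x,R)=[x_1,x_1+R]\times\dots\times[x_d,x_d+R]$. For $0<\theta<1$, the Assouad spectrum of a non-empty set $X\subset\mathbb{R}^d$ is $$\dim_A^\theta X=\inf\{s\ge0: \text{there is a constant } c>0 \text{ such that for all } 0<R<1 \text{ and all } x\in\mathbb{R}^d,\ N_{R^{1/\theta}}(C(x,R)\cap X)\le c\,R^{(1-\frac1\theta)s}\}.$$ *)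

theory Defs
  imports "HOL-Analysis.Analysis"
begin

text \<open>Only the values on \<open>[0,1]\<close> matter. The description is well defined because a rational
  number has a unique reduced denominator, see \<open>popcorn_fraction\<close>.\<close>

definition popcorn :: "real \<Rightarrow> real" where
  "popcorn x =
     (if \<exists>p q :: nat. coprime p q \<and> 1 \<le> p \<and> p < q \<and> x = real p / real q
      then 1 / real (THE q. \<exists>p :: nat. coprime p q \<and> 1 \<le> p \<and> p < q \<and> x = real p / real q)
      else 0)"

definition popcorn_graph :: "(real \<times> real) set" where
  "popcorn_graph = {(x, popcorn x) | x. x \<in> {0..1}}"

definition full_popcorn_set :: "(real \<times> real) set" where
  "full_popcorn_set =
     {(real p / real q, 1 / real q) | p q :: nat. 0 < p \<and> 0 < q \<and> p < q} \<union> {0..1} \<times> {0}"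

text \<open>Cubes are axis-parallel, with \<open>x\<close> as the corner of least coordinates.\<close>

definition cube :: "'a::euclidean_space \<Rightarrow> real \<Rightarrow> 'a set" where
  "cube x R = cbox x (x + R *\<^sub>R One)"

text \<open>Meaningful for bounded \<open>X\<close> and \<open>\<delta> > 0\<close> only, when a finite cover exists.\<close>

definition covering_number :: "real \<Rightarrow> 'a::euclidean_space set \<Rightarrow> nat" where
  "covering_number \<delta> X =
     (LEAST n. \<exists>P. finite P \<and> card P = n \<and> X \<subseteq> (\<Union>p\<in>P. cube p \<delta>))"

text \<open>For \<open>0 < \<theta> < 1\<close> the set below is bounded below by \<open>0\<close> and contains the dimension
  of the ambient space, so the infimum can be taken in the reals.\<close>

definition assouad_spectrum :: "real \<Rightarrow> 'a::euclidean_space set \<Rightarrow> real" where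
  "assouad_spectrum \<theta> X =
     Inf {s. 0 \<le> s \<and>
       (\<exists>c>0. \<forall>R x. 0 < R \<and> R < 1 \<longrightarrow>
          real (covering_number (R powr (1 / \<theta>)) (cube x R \<inter> X))
            \<le> c * R powr ((1 - 1 / \<theta>) * s))}"

lemma popcorn_fraction:
  fixes p q :: nat
  assumes "coprime p q" "1 \<le> p" "p < q"
  shows "popcorn (real p / real q) = 1 / real q"
proof -
  let ?P = "\<lambda>r. \<exists>p' :: nat. coprime p' r \<and> 1 \<le> p' \<and> p' < r \<and> real p / real q = real p' / real r"
  have uniq: "r = q" if "?P r" for r
  proof -
    from that obtain p' where p': "coprime p' r" "p' < r" "real p / real q = real p' / real r"
      by blast
    have "real p * real r = real p' * real q"
      using p' assms by (simp add: field_simps)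
    then have "p * r = p' * q"
      by (metis of_nat_eq_iff of_nat_mult)
    then show ?thesis
      using p'(1) assms(1) by (metis coprime_crossproduct_nat coprime_commute mult.commute)
  qed
  have "?P q" using assms by blast
  then have "(THE r. ?P r) = q" using uniq by blast
  moreover have "\<exists>p' r :: nat. coprime p' r \<and> 1 \<le> p' \<and> p' < r \<and> real p / real q = real p' / real r"
    using \<open>?P q\<close> by blast
  ultimately show ?thesis unfolding popcorn_def by simp
qed

lemma cube_prod: "cube (a :: real, b :: real) R = {a..a + R} \<times> {b..b + R}"
  by (auto simp: cube_def cbox_Pair_eq Basis_prod_def sum.union_disjoint box_real
      sum.reindex inj_on_def mem_box inner_sum_left sum_Basis_prod_eq)

end

theory Submission
  imports Defs "HOL-Number_Theory.Totient" "HOL-Real_Asymp.Real_Asymp"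
begin

text \<open>Write \<open>\<delta> = R\<^sup>1\<^sup>/\<^sup>\<theta>\<close> and split a square of side \<open>R\<close> at height \<open>\<delta>\<^sup>2\<^sup>/\<^sup>3\<close>. The part below is
  covered by a full grid; the part above contains only fractions with denominator less than
  \<open>\<delta>\<^sup>-\<^sup>2\<^sup>/\<^sup>3\<close>, and these are counted one by one. For \<open>\<theta> \<le> 2/3\<close> both contributions are of order
  \<open>R \<delta>\<^sup>-\<^sup>4\<^sup>/\<^sup>3\<close>, which is the upper bound.

  For the lower bound let \<open>\<delta> = Q\<^sup>-\<^sup>3\<^sup>/\<^sup>2\<close> and consider the points \<open>(p/q, 1/q)\<close> with \<open>p/q\<close> reduced and
  \<open>Q \<le> q < 2Q\<close>. There are at least \<open>Q\<^sup>2 / O(log Q)\<close> of them, since \<open>\<phi>(q) \<ge> q / (1 + log\<^sub>2 q)\<close>. Two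
  of them in a common \<open>\<delta>\<close>-square satisfy \<open>\<bar>q - q'\<bar> \<le> 4 \<surd>Q\<close> and \<open>\<bar>p q' - p' q\<bar> \<le> 4 \<surd>Q\<close>, where
  \<open>p q' - p' q\<close> is a non-zero multiple of \<open>gcd q q'\<close>; this leaves only \<open>O(Q\<^sup>2)\<close> close pairs. By
  Cauchy--Schwarz every \<open>\<delta>\<close>-cover of these points has at least \<open>Q\<^sup>2 / O(log\<^sup>2 Q)\<close> squares.
  All the points lie in \<open>[0,1] \<times> [0,1/Q]\<close>, and by pigeonhole one of the \<open>R\<close>-squares tiling this
  strip needs its proportional share of the cover. Comparing powers of \<open>Q\<close> gives the exponent
  in both ranges of \<open>\<theta>\<close>.\<close>

subsection \<open>Covering numbers\<close>

lemma covering_number_le: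
  assumes "finite P" "X \<subseteq> (\<Union>p\<in>P. cube p \<delta>)"
  shows "covering_number \<delta> X \<le> card P"
  unfolding covering_number_def by (rule Least_le) (use assms in blast)

lemma interval_grid_point:
  fixes a x w \<delta> :: real
  assumes "0 < \<delta>" "a \<le> x" "x \<le> a + w"
  obtains i :: nat where "i \<le> nat \<lfloor>w / \<delta>\<rfloor>" "a + real i * \<delta> \<le> x" "x \<le> a + real i * \<delta> + \<delta>"
proof -
  let ?i = "nat \<lfloor>(x - a) / \<delta>\<rfloor>"
  have nn: "0 \<le> (x - a) / \<delta>" using assms by simp
  have 1: "?i \<le> nat \<lfloor>w / \<delta>\<rfloor>"
    using assms by (intro nat_mono floor_mono divide_right_mono) auto
  have r: "real ?i = of_int \<lfloor>(x - a) / \<delta>\<rfloor>" using nn by simp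
  have "real ?i \<le> (x - a) / \<delta>" "(x - a) / \<delta> \<le> real ?i + 1"
    unfolding r by linarith+
  with assms(1) have "a + real ?i * \<delta> \<le> x" "x \<le> a + real ?i * \<delta> + \<delta>"
    by (auto simp: field_simps)
  with 1 show thesis by (rule that)
qed

lemma rectangle_cover:
  fixes a b w h \<delta> :: real
  assumes "0 < \<delta>" "0 \<le> w" "0 \<le> h"
  obtains P where "finite P" "real (card P) \<le> (w / \<delta> + 1) * (h / \<delta> + 1)"
    "{a..a + w} \<times> {b..b + h} \<subseteq> (\<Union>p\<in>P. cube p \<delta>)"
proof -
  let ?I = "{..nat \<lfloor>w / \<delta>\<rfloor>} \<times> {..nat \<lfloor>h / \<delta>\<rfloor>}"
  let ?P = "(\<lambda>(i, j). (a + real i * \<delta>, b + real j * \<delta>)) ` ?I"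
  have fin: "finite ?P" by simp
  have "card ?P \<le> card ?I" by (rule card_image_le) simp
  then have "real (card ?P) \<le> real (card ?I)" by (simp only: of_nat_le_iff)
  also have "\<dots> = (real (nat \<lfloor>w / \<delta>\<rfloor>) + 1) * (real (nat \<lfloor>h / \<delta>\<rfloor>) + 1)"
    by (simp add: card_cartesian_product algebra_simps)
  also have "\<dots> \<le> (w / \<delta> + 1) * (h / \<delta> + 1)"
    using assms by (intro mult_mono add_right_mono) (auto simp: of_nat_floor)
  finally have card: "real (card ?P) \<le> (w / \<delta> + 1) * (h / \<delta> + 1)" .
  have "{a..a + w} \<times> {b..b + h} \<subseteq> (\<Union>p\<in>?P. cube p \<delta>)"
  proof
    fix z assume "z \<in> {a..a + w} \<times> {b..b + h}"
    then obtain x y where xy: "z = (x, y)" "a \<le> x" "x \<le> a + w" "b \<le> y" "y \<le> b + h" by auto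
    obtain i where i: "i \<le> nat \<lfloor>w / \<delta>\<rfloor>" "a + real i * \<delta> \<le> x" "x \<le> a + real i * \<delta> + \<delta>"
      using interval_grid_point assms(1) xy(2,3) by blast
    obtain j where j: "j \<le> nat \<lfloor>h / \<delta>\<rfloor>" "b + real j * \<delta> \<le> y" "y \<le> b + real j * \<delta> + \<delta>"
      using interval_grid_point assms(1) xy(4,5) by blast
    have "(a + real i * \<delta>, b + real j * \<delta>) \<in> ?P" using i j by auto
    moreover have "z \<in> cube (a + real i * \<delta>, b + real j * \<delta>) \<delta>"
      using i j by (simp add: xy(1) cube_prod)
    ultimately show "z \<in> (\<Union>p\<in>?P. cube p \<delta>)" by blast
  qed
  with fin card show thesis by (rule that)
qed

text \<open>\<open>LEAST\<close> only yields a genuine minimal cover once some finite cover exists;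
  the bounding cube supplies one through \<open>rectangle_cover\<close>.\<close>

lemma covering_number_attained:
  fixes X :: "(real \<times> real) set"
  assumes "0 < \<delta>" "X \<subseteq> cube x R" "0 \<le> R"
  obtains P where "finite P" "card P = covering_number \<delta> X" "X \<subseteq> (\<Union>p\<in>P. cube p \<delta>)"
proof -
  obtain a b where x: "x = (a, b)" by (cases x)
  obtain P where "finite P" "{a..a + R} \<times> {b..b + R} \<subseteq> (\<Union>p\<in>P. cube p \<delta>)"
    using rectangle_cover[OF assms(1,3,3)] by metis
  then have "\<exists>n P. finite P \<and> card P = n \<and> X \<subseteq> (\<Union>p\<in>P. cube p \<delta>)"
    using assms(2) unfolding x cube_prod by blast
  from LeastI_ex[OF this] show thesis
    using that unfolding covering_number_def by blast
qed

text \<open>The pigeonhole step in contrapositive form: minimal covers of the pieces in the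
  \<open>R\<close>-squares are glued, so a lower bound for global covers limits how small
  \<open>N\<close> can be.\<close>

lemma cover_of_cube_bounds:
  fixes X Y G :: "(real \<times> real) set"
  assumes "finite G" "0 < R" "0 < \<delta>" "X \<subseteq> Y" "X \<subseteq> (\<Union>g\<in>G. cube g R)"
    and N: "\<And>g. g \<in> G \<Longrightarrow> real (covering_number \<delta> (cube g R \<inter> Y)) \<le> N"
  obtains P where "finite P" "real (card P) \<le> real (card G) * N" "X \<subseteq> (\<Union>p\<in>P. cube p \<delta>)"
proof -
  have "\<exists>P. finite P \<and> real (card P) \<le> N \<and> cube g R \<inter> Y \<subseteq> (\<Union>p\<in>P. cube p \<delta>)" if "g \<in> G" for g
    using covering_number_attained[of \<delta> "cube g R \<inter> Y" g R] assms(2,3) N[OF that]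
    by (metis inf_le1 less_imp_le)
  then obtain P where P: "\<And>g. g \<in> G \<Longrightarrow> finite (P g)" "\<And>g. g \<in> G \<Longrightarrow> real (card (P g)) \<le> N"
    "\<And>g. g \<in> G \<Longrightarrow> cube g R \<inter> Y \<subseteq> (\<Union>p\<in>P g. cube p \<delta>)"
    by metis
  have "card (\<Union>g\<in>G. P g) \<le> (\<Sum>g\<in>G. card (P g))"
    using assms(1) by (rule card_UN_le)
  then have "real (card (\<Union>g\<in>G. P g)) \<le> (\<Sum>g\<in>G. real (card (P g)))"
    by (simp only: of_nat_sum[symmetric] of_nat_le_iff)
  also have "\<dots> \<le> real (card G) * N"
    using P(2) by (rule sum_bounded_above)
  finally have "real (card (\<Union>g\<in>G. P g)) \<le> real (card G) * N" .
  moreover have "finite (\<Union>g\<in>G. P g)" using assms(1) P(1) by blast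
  moreover have "X \<subseteq> (\<Union>p\<in>(\<Union>g\<in>G. P g). cube p \<delta>)"
  proof
    fix x assume "x \<in> X"
    with assms(4,5) obtain g where g: "g \<in> G" "x \<in> cube g R \<inter> Y" by blast
    with P(3)[OF g(1)] obtain p where "p \<in> P g" "x \<in> cube p \<delta>" by blast
    with g(1) show "x \<in> (\<Union>p\<in>(\<Union>g\<in>G. P g). cube p \<delta>)" by blast
  qed
  ultimately show thesis using that by blast
qed

subsection \<open>Counting\<close>

lemma card_nat_interval_le:
  fixes a b :: real
  assumes "a \<le> b"
  shows "finite {p :: nat. a \<le> real p \<and> real p \<le> b}"
    and "real (card {p :: nat. a \<le> real p \<and> real p \<le> b}) \<le> b - a + 1"
proof -
  let ?S = "{p :: nat. a \<le> real p \<and> real p \<le> b}"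
  have sub: "int ` ?S \<subseteq> {\<lceil>a\<rceil>..\<lfloor>b\<rfloor>}"
    by (auto simp: ceiling_le_iff le_floor_iff)
  show "finite ?S"
    using finite_subset[OF sub] by (auto dest: finite_imageD simp: inj_on_def)
  have "card ?S = card (int ` ?S)" by (simp add: card_image)
  also have "\<dots> \<le> card {\<lceil>a\<rceil>..\<lfloor>b\<rfloor>}" using sub by (intro card_mono) auto
  finally have "real (card ?S) \<le> real (nat (\<lfloor>b\<rfloor> - \<lceil>a\<rceil> + 1))" by simp
  also have "\<dots> \<le> b - a + 1" using assms by linarith
  finally show "real (card ?S) \<le> b - a + 1" .
qed

lemma card_nonzero_int_le:
  fixes H :: real
  assumes "0 \<le> H"
  shows "finite {k :: int. k \<noteq> 0 \<and> \<bar>real_of_int k\<bar> \<le> H}"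
    and "real (card {k :: int. k \<noteq> 0 \<and> \<bar>real_of_int k\<bar> \<le> H}) \<le> 2 * H"
proof -
  let ?S = "{k :: int. k \<noteq> 0 \<and> \<bar>real_of_int k\<bar> \<le> H}"
  have eq: "?S = {- \<lfloor>H\<rfloor>..\<lfloor>H\<rfloor>} - {0}"
    by (auto simp: abs_le_iff le_floor_iff) (linarith+)?
  show "finite ?S" unfolding eq by simp
  have "0 \<le> \<lfloor>H\<rfloor>" using assms by simp
  then have "nat (2 * \<lfloor>H\<rfloor> + 1) - 1 = nat (2 * \<lfloor>H\<rfloor>)" by linarith
  then have "card ?S = nat (2 * \<lfloor>H\<rfloor>)"
    unfolding eq using assms by (subst card_Diff_singleton) auto
  then have "real (card ?S) = real (nat (2 * \<lfloor>H\<rfloor>))" by simp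
  also have "\<dots> \<le> 2 * H" using assms by linarith
  finally show "real (card ?S) \<le> 2 * H" .
qed

text \<open>Cauchy-Schwarz applied to the fibre sizes of \<open>f\<close>: they sum to
  \<open>card A\<close>, and their squares sum to the number of colliding pairs.\<close>

lemma card_sq_le_card_collisions:
  assumes "finite A"
  shows "(real (card A))\<^sup>2 \<le> real (card (f ` A)) * real (card {(a, b) \<in> A \<times> A. f a = f b})"
proof -
  let ?B = "\<lambda>y. {a \<in> A. f a = y}"
  have "real (card A) = (\<Sum>y\<in>f ` A. real (card (?B y)))"
    using sum.image_gen[OF assms, of "\<lambda>_. 1::real" f] by simp
  then have "(real (card A))\<^sup>2 = (\<Sum>y\<in>f ` A. 1 * real (card (?B y)))\<^sup>2" by simp
  also have "\<dots> \<le> (\<Sum>y\<in>f ` A. 1\<^sup>2) * (\<Sum>y\<in>f ` A. (real (card (?B y)))\<^sup>2)"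
    by (rule Cauchy_Schwarz_ineq_sum)
  also have "(\<Sum>y\<in>f ` A. (real (card (?B y)))\<^sup>2) = real (card (SIGMA y:f ` A. ?B y \<times> ?B y))"
    using assms by (subst card_SigmaI) (auto simp: card_cartesian_product power2_eq_square)
  \<comment> \<open>\<open>snd\<close> forgets the fibre index, which the pair itself
    determines.\<close>
  also have "card (SIGMA y:f ` A. ?B y \<times> ?B y) = card {(a, b) \<in> A \<times> A. f a = f b}"
    by (rule bij_betw_same_card[of snd])
       (auto simp: bij_betw_def inj_on_def image_iff)
  finally show ?thesis by simp
qed

section \<open>A lower bound for Euler's totient\<close>

text \<open>The worst case is an initial segment 2, 3, ..., where the product telescopes. Adding
  elements in increasing order, a new maximum \<open>b\<close> is at least
  \<open>card A + 2\<close>.\<close>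

lemma prod_one_minus_inverse_ge:
  fixes S :: "nat set"
  assumes "finite S" "\<And>m. m \<in> S \<Longrightarrow> 2 \<le> m"
  shows "1 / (real (card S) + 1) \<le> (\<Prod>m\<in>S. 1 - 1 / real m)"
  using assms
proof (induction rule: finite_linorder_max_induct)
  case empty
  then show ?case by simp
next
  case (insert b A)
  have "A \<subseteq> {2..<b}" using insert by auto
  then have "card A \<le> card {2..<b}" by (intro card_mono) auto
  moreover have "2 \<le> b" using insert by auto
  ultimately have b: "real (card A) + 2 \<le> real b" by simp
  have notin: "b \<notin> A" using insert by auto
  have "1 / (real (card A) + 2) = (1 - 1 / (real (card A) + 2)) * (1 / (real (card A) + 1))"
    by (simp add: divide_simps) 
  also have "\<dots> \<le> (1 - 1 / real b) * (\<Prod>m\<in>A. 1 - 1 / real m)"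
    using insert b by (intro mult_mono) (auto simp: field_simps)
  finally show ?case using insert notin by (simp add: add.commute)
qed

text \<open>The distinct primes dividing \<open>n\<close> are at least 2 and their product is at
  most \<open>n\<close>, so there are at most log_2 n of them; Euler's product is then bounded by
  the previous lemma.\<close>

lemma totient_lower_bound:
  assumes "0 < n"
  shows "real n / (log 2 (real n) + 1) \<le> real (totient n)"
proof -
  let ?S = "prime_factors n"
  have "2 ^ card ?S \<le> (\<Prod>p\<in>?S. p)"
    using prod_mono[of ?S "\<lambda>_. 2" "\<lambda>p. p"] by (auto dest: prime_ge_2_nat in_prime_factors_imp_prime)
  also have "\<dots> \<le> n"
    using prod_mono[of ?S "\<lambda>p. p" "\<lambda>p. p ^ multiplicity p n"] prime_factorization_nat[OF assms]
    by (auto simp: prime_factors_multiplicity self_le_power prime_gt_0_nat Suc_leI)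
  finally have "2 ^ card ?S \<le> n" .
  then have "real (card ?S) \<le> log 2 (real n)"
    using assms by (simp add: le_log_of_power)
  then have "real n / (log 2 (real n) + 1) \<le> real n * (1 / (real (card ?S) + 1))"
    using assms by (simp add: frac_le)
  also have "\<dots> \<le> real n * (\<Prod>p\<in>?S. 1 - 1 / real p)"
    by (intro mult_left_mono prod_one_minus_inverse_ge) (auto dest: prime_ge_2_nat in_prime_factors_imp_prime)
  also have "\<dots> = real (totient n)" by (simp add: totient_formula2)
  finally show ?thesis .
qed

text \<open>The gcd \<open>d\<close> cancels: the cross difference is a non-zero multiple of
  \<open>d\<close>, which leaves at most 2H/d values, and each value is attained by at most
  \<open>d\<close> pairs.\<close>

lemma card_near_fractions_le:
  fixes q q' :: nat and H :: real
  assumes "q \<noteq> q'" "0 < q" "0 < q'" "0 \<le> H"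
  defines "S \<equiv> {(p, p'). p \<in> totatives q \<and> p' \<in> totatives q' \<and>
                         \<bar>real p * real q' - real p' * real q\<bar> \<le> H}"
  shows "real (card S) \<le> 2 * H"
proof -
  define d where "d = gcd q q'"
  obtain u v where uv: "q = d * u" "q' = d * v" "coprime u v"
    using gcd_coprime_exists[of q q'] assms(2) unfolding d_def by (metis gcd_eq_0_iff mult.commute neq0_conv)
  have pos: "0 < d" "0 < u" "0 < v" using assms uv by auto
  let ?K = "{k :: int. k \<noteq> 0 \<and> \<bar>real_of_int k\<bar> \<le> H / real d}"
  let ?g = "\<lambda>(p, p'). (int p * int v - int p' * int u, (p - 1) div u)"
  \<comment> \<open>\<open>p v - p' u\<close> determines \<open>p\<close> modulo \<open>u\<close>, and \<open>p - 1\<close> runs over the \<open>d\<close> blocks of length \<open>u\<close>.\<close>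
  have "inj_on ?g S"
  proof (rule inj_onI, clarsimp simp: S_def)
    fix p p' r r'
    assume *: "p \<in> totatives q" "r \<in> totatives q" "(p - Suc 0) div u = (r - Suc 0) div u"
      "int p * int v - int p' * int u = int r * int v - int r' * int u"
    have "(int p - int r) * int v = (int p' - int r') * int u"
      using *(4) by (simp add: algebra_simps)
    then have "int u dvd (int p - int r) * int v" by simp
    then have "int u dvd int p - int r"
      using uv(3) by (simp add: coprime_dvd_mult_left_iff)
    then have "int u dvd int (p - 1) - int (r - 1)"
      using *(1,2) by (auto simp: totatives_def of_nat_diff)
    then have "(p - 1) mod u = (r - 1) mod u"
      by (metis mod_eq_dvd_iff of_nat_eq_iff zmod_int)
    with *(3) have "p - 1 = r - 1"
      by (metis One_nat_def div_mult_mod_eq)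
    then have "p = r" using *(1,2) by (auto simp: totatives_def)
    with *(4) pos show "p = r \<and> p' = r'" by simp
  qed
  moreover have "?g ` S \<subseteq> ?K \<times> {..<d}"
  proof (clarsimp simp: S_def)
    fix p p'
    assume *: "p \<in> totatives q" "p' \<in> totatives q'" "\<bar>real p * real q' - real p' * real q\<bar> \<le> H"
    \<comment> \<open>Reduced fractions with different denominators are different numbers.\<close>
    have "p * q' \<noteq> p' * q"
      using *(1,2) assms(1) coprime_crossproduct_nat[of p q p' q']
      by (auto simp: totatives_def coprime_commute mult.commute)
    then have "p * v \<noteq> p' * u" using uv by auto
    then have "int p * int v \<noteq> int p' * int u" by (metis of_nat_eq_iff of_nat_mult)
    moreover have "real p * real q' - real p' * real q = real d * (real p * real v - real p' * real u)"
      using uv by (simp add: algebra_simps)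
    with *(3) have "real d * \<bar>real p * real v - real p' * real u\<bar> \<le> H"
      by (simp add: abs_mult)
    then have "\<bar>real p * real v - real p' * real u\<bar> \<le> H / real d"
      using pos by (simp add: pos_le_divide_eq mult.commute)
    \<comment> \<open>The shift by one keeps the block index below \<open>d\<close> even for q = 1,
      whose only totative is 1 = q.\<close>
    moreover have "(p - 1) div u < d"
      using *(1) pos uv by (intro div_less_iff_less_mult[THEN iffD2]) (auto simp: totatives_def)
    ultimately show "int p * int v \<noteq> int p' * int u \<and>
        \<bar>real p * real v - real p' * real u\<bar> \<le> H / real d \<and> (p - Suc 0) div u < d"
      by simp
  qed
  ultimately have "card S \<le> card (?K \<times> {..<d})"
    using card_nonzero_int_le(1)[of "H / real d"] assms(4)
    by (intro card_inj_on_le) auto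
  then have "real (card S) \<le> real (card ?K) * real d"
    by (metis card_cartesian_product card_lessThan of_nat_le_iff of_nat_mult)
  also have "\<dots> \<le> (2 * (H / real d)) * real d"
    using assms(4) by (intro mult_right_mono card_nonzero_int_le) auto
  also have "\<dots> = 2 * H" using pos by simp
  finally show ?thesis .
qed

subsection \<open>Reduced fractions with denominator between Q and 2Q\<close>

definition middle_fractions :: "nat \<Rightarrow> (nat \<times> nat) set" where
  "middle_fractions Q = (SIGMA q:{Q..<2 * Q}. totatives q)"

lemma finite_middle_fractions [simp]: "finite (middle_fractions Q)"
  by (simp add: middle_fractions_def)

lemma card_middle_fractions_ge:
  assumes "0 < Q"
  shows "(real Q)\<^sup>2 / (log 2 (2 * real Q) + 1) \<le> real (card (middle_fractions Q))"
proof -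
  have "(real Q)\<^sup>2 / (log 2 (2 * real Q) + 1) = (\<Sum>q\<in>{Q..<2 * Q}. real Q / (log 2 (2 * real Q) + 1))"
    by (simp add: power2_eq_square)
  also have "\<dots> \<le> (\<Sum>q\<in>{Q..<2 * Q}. real (totient q))"
  proof (rule sum_mono)
    fix q assume q: "q \<in> {Q..<2 * Q}"
    have "real Q / (log 2 (2 * real Q) + 1) \<le> real q / (log 2 (real q) + 1)"
      using q assms by (intro frac_le add_right_mono log_mono add_nonneg_pos) auto
    also have "\<dots> \<le> real (totient q)" using q assms by (intro totient_lower_bound) auto
    finally show "real Q / (log 2 (2 * real Q) + 1) \<le> real (totient q)" .
  qed
  also have "\<dots> = real (card (middle_fractions Q))"
    by (simp add: middle_fractions_def totient_def)
  finally show ?thesis .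
qed

lemma card_middle_fractions_le: "card (middle_fractions Q) \<le> 2 * Q\<^sup>2"
proof -
  have "card (middle_fractions Q) = (\<Sum>q\<in>{Q..<2 * Q}. totient q)"
    by (simp add: middle_fractions_def totient_def)
  also have "\<dots> \<le> (\<Sum>q\<in>{Q..<2 * Q}. 2 * Q)"
  proof (rule sum_mono)
    fix q assume "q \<in> {Q..<2 * Q}"
    then show "totient q \<le> 2 * Q" using totient_le[of q] by simp
  qed
  finally show ?thesis by (simp add: power2_eq_square)
qed

text \<open>There are \<open>Q\<close> choices of \<open>q\<close>, then at most 2H of
  \<open>q'\<close>, then at most 2H of the two numerators. The last bound is free of the gcd, so no
  logarithm arises.\<close>

lemma card_near_pairs_le:
  fixes H :: real
  assumes "0 < Q" "0 \<le> H"
  shows "real (card {((q, p), (q', p')). (q, p) \<in> middle_fractions Q \<and> (q', p') \<in> middle_fractions Q \<and>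
            q \<noteq> q' \<and> \<bar>real q - real q'\<bar> \<le> H \<and> \<bar>real p * real q' - real p' * real q\<bar> \<le> H})
         \<le> 4 * real Q * H\<^sup>2" (is "real (card ?N) \<le> _")
proof -
  let ?E = "\<lambda>q. {q' \<in> {Q..<2 * Q}. q \<noteq> q' \<and> \<bar>real q - real q'\<bar> \<le> H}"
  let ?S = "\<lambda>q q'. {(p, p'). p \<in> totatives q \<and> p' \<in> totatives q' \<and>
                         \<bar>real p * real q' - real p' * real q\<bar> \<le> H}"
  let ?D = "SIGMA q:{Q..<2 * Q}. ?E q"
  let ?T = "SIGMA x:?D. ?S (fst x) (snd x)"
  have finS: "finite (?S q q')" for q q'
    by (rule finite_subset[of _ "totatives q \<times> totatives q'"]) auto
  have E: "real (card (?E q)) \<le> 2 * H" for q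
  proof -
    have "card (?E q) \<le> card {k :: int. k \<noteq> 0 \<and> \<bar>real_of_int k\<bar> \<le> H}"
      using card_nonzero_int_le(1)[OF assms(2)]
      by (intro card_inj_on_le[of "\<lambda>q'. int q - int q'"]) (auto simp: inj_on_def)
    then show ?thesis using card_nonzero_int_le(2)[OF assms(2)] by linarith
  qed
  have "?N \<subseteq> (\<lambda>((q, q'), (p, p')). ((q, p), (q', p'))) ` ?T"
    by (force simp: middle_fractions_def)
  then have "card ?N \<le> card ?T"
    using finS by (intro surj_card_le) auto
  then have "real (card ?N) \<le> real (card ?T)" by simp
  also have "\<dots> = (\<Sum>x\<in>?D. real (card (?S (fst x) (snd x))))"
    using finS by (subst card_SigmaI) auto
  also have "\<dots> \<le> (\<Sum>x\<in>?D. 2 * H)"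
    using assms by (intro sum_mono card_near_fractions_le) auto
  also have "\<dots> = (\<Sum>q\<in>{Q..<2 * Q}. real (card (?E q))) * (2 * H)"
    by (simp add: card_SigmaI)
  also have "\<dots> \<le> (\<Sum>q\<in>{Q..<2 * Q}. 2 * H) * (2 * H)"
    using assms E by (intro mult_right_mono sum_mono) auto
  finally show ?thesis by (simp add: power2_eq_square)
qed

section \<open>Covers of the graph points over the middle fractions\<close>

definition fraction_point :: "nat \<times> nat \<Rightarrow> real \<times> real" where
  "fraction_point = (\<lambda>(q, p). (real p / real q, 1 / real q))"

lemma fraction_point_in_popcorn_graph:
  assumes "a \<in> middle_fractions Q" "2 \<le> Q"
  shows "fraction_point a \<in> popcorn_graph" "fraction_point a \<in> {0..1} \<times> {0..1 / real Q}"
proof -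
  obtain q p where a: "a = (q, p)" by (cases a)
  with assms have qp: "Q \<le> q" "p \<in> totatives q" by (auto simp: middle_fractions_def)
  \<comment> \<open>This uses q > 1: the totative of 1 is 1 itself, and the popcorn function
    excludes p = q.\<close>
  then have "p < q" using totatives_less[of p q] assms by simp
  with qp have p: "coprime p q" "1 \<le> p" "p < q" by (auto simp: totatives_def)
  then have "fraction_point a = (real p / real q, popcorn (real p / real q))"
    by (simp add: a fraction_point_def popcorn_fraction)
  moreover have "real p / real q \<in> {0..1}" using p by auto
  ultimately show "fraction_point a \<in> popcorn_graph" unfolding popcorn_graph_def by blast
  show "fraction_point a \<in> {0..1} \<times> {0..1 / real Q}"
    using p qp assms by (auto simp: a fraction_point_def frac_le)
qed

text \<open>Multiplying by q q' \<le> 4 Q^2 clears denominators. It serves both coordinates: with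
  the numerators it bounds the cross difference, and with x = y = 1 the difference of the
  denominators.\<close>

lemma abs_cross_diff_le:
  fixes x y q q' Q :: real
  assumes "\<bar>x / q - y / q'\<bar> \<le> 1 / (Q * sqrt Q)" "0 < q" "q \<le> 2 * Q" "0 < q'" "q' \<le> 2 * Q"
  shows "\<bar>x * q' - y * q\<bar> \<le> 4 * sqrt Q"
proof -
  have Q: "0 < Q" using assms by linarith
  have "x * q' - y * q = (x / q - y / q') * (q * q')"
    using assms by (simp add: field_simps)
  then have "\<bar>x * q' - y * q\<bar> = \<bar>x / q - y / q'\<bar> * (q * q')"
    using assms by (simp add: abs_mult)
  also have "\<dots> \<le> 1 / (Q * sqrt Q) * ((2 * Q) * (2 * Q))"
    using assms Q by (intro mult_mono) auto
  also have "\<dots> = 4 * (Q / sqrt Q)" using Q by (simp add: field_simps)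
  also have "\<dots> = 4 * sqrt Q" using Q by (simp add: real_div_sqrt)
  finally show ?thesis .
qed

text \<open>Assign to each point one square containing it. The colliding pairs are the diagonal, at
  most 2 Q^2, and the near pairs with H = 4 sqrt Q, at most 64 Q^2; hence the constant 66.\<close>

lemma card_cover_middle_fractions_ge:
  assumes "5 \<le> Q" "finite P"
    and cover: "fraction_point ` middle_fractions Q \<subseteq> (\<Union>x\<in>P. cube x (1 / (real Q * sqrt (real Q))))"
  shows "(real Q)\<^sup>2 \<le> 66 * (log 2 (2 * real Q) + 1)\<^sup>2 * real (card P)"
proof -
  let ?A = "middle_fractions Q" and ?\<delta> = "1 / (real Q * sqrt (real Q))" and ?L = "log 2 (2 * real Q) + 1"
  let ?H = "4 * sqrt (real Q)"
  let ?N = "{((q, p), (q', p')). (q, p) \<in> ?A \<and> (q', p') \<in> ?A \<and>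
            q \<noteq> q' \<and> \<bar>real q - real q'\<bar> \<le> ?H \<and> \<bar>real p * real q' - real p' * real q\<bar> \<le> ?H}"
  have "\<forall>a\<in>?A. \<exists>x\<in>P. fraction_point a \<in> cube x ?\<delta>" using cover by blast
  then obtain f where f: "\<And>a. a \<in> ?A \<Longrightarrow> f a \<in> P" "\<And>a. a \<in> ?A \<Longrightarrow> fraction_point a \<in> cube (f a) ?\<delta>"
    by metis
  have Q: "0 < real Q" "2 < sqrt (real Q)" using assms(1) by (auto simp: real_less_rsqrt)
  have L: "0 < ?L" using assms(1) by (auto intro!: add_nonneg_pos)
  have sub: "{(a, b) \<in> ?A \<times> ?A. f a = f b} \<subseteq> (\<lambda>a. (a, a)) ` ?A \<union> ?N"
  proof (rule subsetI, rule UnCI)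
    fix x assume x: "x \<in> {(a, b) \<in> ?A \<times> ?A. f a = f b}" "x \<notin> ?N"
    obtain q p q' p' where xeq: "x = ((q, p), (q', p'))" by (metis surj_pair)
    have *: "(q, p) \<in> ?A" "(q', p') \<in> ?A" "f (q, p) = f (q', p')"
      "\<not> (q \<noteq> q' \<and> \<bar>real q - real q'\<bar> \<le> ?H \<and> \<bar>real p * real q' - real p' * real q\<bar> \<le> ?H)"
      using x unfolding xeq by blast+
    obtain u v where uv: "f (q, p) = (u, v)" by (cases "f (q, p)")
    have near: "\<bar>real p / real q - real p' / real q'\<bar> \<le> ?\<delta>" "\<bar>1 / real q' - 1 / real q\<bar> \<le> ?\<delta>"
      using f(2)[OF *(1)] f(2)[OF *(2)] unfolding *(3)[symmetric] uv by (simp_all add: fraction_point_def cube_prod abs_le_iff)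
    have q: "0 < real q" "real q \<le> 2 * real Q" "0 < real q'" "real q' \<le> 2 * real Q"
      using *(1,2) assms(1) by (auto simp: middle_fractions_def)
    have "q = q'"
      using *(4) abs_cross_diff_le[OF near(1) q] abs_cross_diff_le[OF near(2) q(3,4,1,2)] by auto
    \<comment> \<open>With a common denominator, distinct numerators give abscissae at least 1/(2Q)
      apart. Since sqrt Q > 2, this exceeds the side of a square.\<close>
    moreover have "p = p'"
    proof (rule ccontr)
      assume "p \<noteq> p'"
      then have "1 \<le> \<bar>real p - real p'\<bar>" by linarith
      also have "\<dots> = \<bar>real p / real q - real p' / real q'\<bar> * real q"
        using q \<open>q = q'\<close> by (simp add: abs_mult[symmetric] field_simps)
      also have "\<dots> \<le> ?\<delta> * (2 * real Q)"
        using near(1) q by (intro mult_mono) auto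
      also have "\<dots> < 1" using Q by (simp add: field_simps)
      finally show False by simp
    qed
    ultimately show "x \<in> (\<lambda>a. (a, a)) ` ?A" unfolding xeq using *(1) by auto
  qed
  have finN: "finite ?N" by (rule finite_subset[of _ "?A \<times> ?A"]) auto
  have "card {(a, b) \<in> ?A \<times> ?A. f a = f b} \<le> card ((\<lambda>a. (a, a)) ` ?A \<union> ?N)"
    using finN by (intro card_mono[OF _ sub]) simp
  also have "\<dots> \<le> card ?A + card ?N"
    by (rule order.trans[OF card_Un_le]) (simp add: card_image_le)
  finally have "real (card {(a, b) \<in> ?A \<times> ?A. f a = f b}) \<le> real (card ?A) + real (card ?N)"
    by (simp only: of_nat_add[symmetric] of_nat_le_iff)
  also have "real (card ?A) \<le> real (2 * Q\<^sup>2)"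
    using card_middle_fractions_le by (simp only: of_nat_le_iff)
  also have "real (card ?N) \<le> 4 * real Q * ?H\<^sup>2"
    using assms(1) by (intro card_near_pairs_le) auto
  finally have coll: "real (card {(a, b) \<in> ?A \<times> ?A. f a = f b}) \<le> 66 * (real Q)\<^sup>2"
    by (simp add: power_mult_distrib power2_eq_square)
  have "card (f ` ?A) \<le> card P" using f(1) assms(2) by (intro card_mono) auto
  then have cardP: "real (card (f ` ?A)) \<le> real (card P)" by simp
  have "((real Q)\<^sup>2 / ?L)\<^sup>2 \<le> (real (card ?A))\<^sup>2"
    using assms(1) L by (intro power_mono card_middle_fractions_ge) auto
  also have "\<dots> \<le> real (card (f ` ?A)) * real (card {(a, b) \<in> ?A \<times> ?A. f a = f b})"
    by (rule card_sq_le_card_collisions) simp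
  also have "\<dots> \<le> real (card P) * (66 * (real Q)\<^sup>2)"
    using coll cardP by (intro mult_mono) auto
  finally have "((real Q)\<^sup>2)\<^sup>2 \<le> real (card P) * (66 * (real Q)\<^sup>2) * ?L\<^sup>2"
    by (simp only: power_divide pos_divide_le_eq[OF zero_less_power[OF L]])
  then have "(real Q)\<^sup>2 * (real Q)\<^sup>2 \<le> (66 * ?L\<^sup>2 * real (card P)) * (real Q)\<^sup>2"
    by (simp only: power2_eq_square[of "(real Q)\<^sup>2"] mult_ac)
  then show ?thesis by (rule mult_right_le_imp_le) (use Q in simp)
qed

subsection \<open>Upper bounds for the Assouad spectrum\<close>

text \<open>The condition inside the infimum of \<open>assouad_spectrum\<close>, isolated so that
  single exponents can be tested.\<close>

definition assouad_exponent :: "real \<Rightarrow> 'a::euclidean_space set \<Rightarrow> real \<Rightarrow> bool" where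
  "assouad_exponent \<theta> X s \<longleftrightarrow>
     (\<exists>c>0. \<forall>R x. 0 < R \<and> R < 1 \<longrightarrow>
        real (covering_number (R powr (1 / \<theta>)) (cube x R \<inter> X)) \<le> c * R powr ((1 - 1 / \<theta>) * s))"

text \<open>The upper bounds hold at the critical exponent itself, without an epsilon loss, so the
  infimum can be treated as a minimum.\<close>

lemma assouad_spectrum_eqI:
  assumes "0 \<le> d" "assouad_exponent \<theta> X d" "\<And>s. 0 \<le> s \<Longrightarrow> assouad_exponent \<theta> X s \<Longrightarrow> d \<le> s"
  shows "assouad_spectrum \<theta> X = d"
  unfolding assouad_spectrum_def assouad_exponent_def[symmetric]
  by (rule cInf_eq_minimum) (use assms in auto)

text \<open>It transfers upper bounds from the full set to the graph and lower bounds from the graph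
  to the full set.\<close>

lemma assouad_exponent_mono:
  fixes X Y :: "(real \<times> real) set"
  assumes "assouad_exponent \<theta> Y s" "X \<subseteq> Y"
  shows "assouad_exponent \<theta> X s"
proof -
  have *: "covering_number (R powr (1 / \<theta>)) (cube x R \<inter> X) \<le> covering_number (R powr (1 / \<theta>)) (cube x R \<inter> Y)"
    if "0 < R" for R x
  proof -
    obtain P where "finite P" "card P = covering_number (R powr (1 / \<theta>)) (cube x R \<inter> Y)"
      "cube x R \<inter> Y \<subseteq> (\<Union>p\<in>P. cube p (R powr (1 / \<theta>)))"
      using covering_number_attained[of "R powr (1 / \<theta>)" "cube x R \<inter> Y" x R] \<open>0 < R\<close>
      by (metis inf_le1 less_imp_le powr_gt_zero less_irrefl)
    moreover from this(3) assms(2) have "cube x R \<inter> X \<subseteq> (\<Union>p\<in>P. cube p (R powr (1 / \<theta>)))"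
      by blast
    ultimately show ?thesis using covering_number_le by metis
  qed
  obtain c where "c > 0" "\<And>R x. 0 < R \<Longrightarrow> R < 1 \<Longrightarrow>
      real (covering_number (R powr (1 / \<theta>)) (cube x R \<inter> Y)) \<le> c * R powr ((1 - 1 / \<theta>) * s)"
    using assms(1) unfolding assouad_exponent_def by blast
  then show ?thesis
    unfolding assouad_exponent_def
    by (intro exI[of _ c]) (meson * of_nat_mono order_trans)
qed

lemma assouad_exponent_two:
  fixes X :: "(real \<times> real) set"
  assumes "0 < \<theta>" "\<theta> < 1"
  shows "assouad_exponent \<theta> X 2"
  unfolding assouad_exponent_def
proof (intro exI[of _ 4] conjI allI impI)
  fix R :: real and x :: "real \<times> real" assume R: "0 < R \<and> R < 1"
  define \<delta> where "\<delta> = R powr (1 / \<theta>)"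
  have "R powr (1 / \<theta>) \<le> R powr 1"
    using R assms by (intro powr_mono') auto
  then have \<delta>: "0 < \<delta>" "\<delta> \<le> R" using R by (auto simp: \<delta>_def)
  obtain a b where x: "x = (a, b)" by (cases x)
  obtain P where P: "finite P" "real (card P) \<le> (R / \<delta> + 1) * (R / \<delta> + 1)"
    "{a..a + R} \<times> {b..b + R} \<subseteq> (\<Union>p\<in>P. cube p \<delta>)"
    using rectangle_cover[OF \<delta>(1)] R by (metis less_imp_le)
  have "covering_number \<delta> (cube x R \<inter> X) \<le> card P"
    using P(1,3) by (intro covering_number_le) (auto simp: x cube_prod)
  then have "real (covering_number \<delta> (cube x R \<inter> X)) \<le> (R / \<delta> + 1) * (R / \<delta> + 1)"
    using P(2) by linarith
  also have "\<dots> \<le> (2 * (R / \<delta>)) * (2 * (R / \<delta>))"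
    using \<delta> R by (intro mult_mono) (auto simp: field_simps)
  also have "\<dots> = 4 * (R powr (1 - 1 / \<theta>))\<^sup>2"
    using R by (simp add: \<delta>_def powr_diff power2_eq_square)
  also have "\<dots> = 4 * R powr ((1 - 1 / \<theta>) * 2)"
    using R by (simp add: powr_power algebra_simps)
  finally show "real (covering_number (R powr (1 / \<theta>)) (cube x R \<inter> X)) \<le> 4 * R powr ((1 - 1 / \<theta>) * 2)"
    unfolding \<delta>_def .
qed simp

text \<open>Here K = \<delta>^(-2/3), and the cut is at height 1/K. The grid below costs at most 4 R
  / (K \<delta>^2) = 4 R K^2. Above it q < K, and each \<open>q\<close> admits at most R K + 1 \<le>
  2 R K numerators, which adds 2 R K^2. The inequalities on \<open>K\<close> absorb the rounding
  terms.\<close>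

lemma covering_number_full_popcorn_le:
  fixes \<delta> R K a b :: real
  assumes "0 < \<delta>" "\<delta> \<le> R" "1 \<le> R * K" "\<delta> * K \<le> 1" "0 < K" "\<delta>\<^sup>2 * K ^ 3 = 1"
  shows "real (covering_number \<delta> (cube (a, b) R \<inter> full_popcorn_set)) \<le> 6 * (R * K\<^sup>2)"
proof -
  have R: "0 < R" using assms by linarith
  let ?F = "\<lambda>q :: nat. {p :: nat. a * real q \<le> real p \<and> real p \<le> a * real q + R * real q}"
  let ?I = "{1..nat \<lfloor>K\<rfloor>}"
  \<comment> \<open>Each point above the strip becomes the corner of its own square.\<close>
  let ?T = "(\<lambda>(q, p). (real p / real q, 1 / real q)) ` (SIGMA q:?I. ?F q)"
  have F: "finite (?F q)" "real (card (?F q)) \<le> R * real q + 1" for q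
    using card_nat_interval_le[of "a * real q" "a * real q + R * real q"] R by auto
  obtain P where P: "finite P" "real (card P) \<le> (R / \<delta> + 1) * ((1 / K) / \<delta> + 1)"
    "{a..a + R} \<times> {0..0 + 1 / K} \<subseteq> (\<Union>p\<in>P. cube p \<delta>)"
    using rectangle_cover[OF assms(1), of R "1 / K"] R assms(5) by (metis less_imp_le zero_less_divide_1_iff)
  have "1 / K / \<delta> \<ge> 1" using assms by (simp add: field_simps)
  then have "(R / \<delta> + 1) * ((1 / K) / \<delta> + 1) \<le> (2 * (R / \<delta>)) * (2 * (1 / K / \<delta>))"
    using assms R by (intro mult_mono) (auto simp: field_simps)
  also have "\<dots> = 4 * (R * (1 / (K * \<delta>\<^sup>2)))" by (simp add: power2_eq_square)
  also have "1 / (K * \<delta>\<^sup>2) = K\<^sup>2"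
    using assms by (simp add: field_simps power2_eq_square power3_eq_cube)
  finally have cardP: "real (card P) \<le> 4 * (R * K\<^sup>2)" using P(2) by linarith
  have "card ?T \<le> card (SIGMA q:?I. ?F q)"
    using F(1) by (intro card_image_le) auto
  also have "\<dots> = (\<Sum>q\<in>?I. card (?F q))"
    using F(1) by (subst card_SigmaI) auto
  finally have "real (card ?T) \<le> (\<Sum>q\<in>?I. real (card (?F q)))"
    by (simp only: of_nat_sum[symmetric] of_nat_le_iff)
  also have "\<dots> \<le> (\<Sum>q\<in>?I. R * K + R * K)"
  proof (rule sum_mono)
    fix q assume "q \<in> ?I"
    then have "real q \<le> K" using assms(5) by (simp add: le_nat_floor) linarith
    then have "R * real q \<le> R * K" using R by simp
    with F(2)[of q] assms(3) show "real (card (?F q)) \<le> R * K + R * K" by linarith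
  qed
  also have "\<dots> = real (nat \<lfloor>K\<rfloor>) * (2 * (R * K))" by simp
  also have "\<dots> \<le> K * (2 * (R * K))"
    using assms(5) R by (intro mult_right_mono) auto
  finally have cardT: "real (card ?T) \<le> 2 * (R * K\<^sup>2)" by (simp add: power2_eq_square mult_ac)
  have "cube (a, b) R \<inter> full_popcorn_set \<subseteq> (\<Union>p\<in>P \<union> ?T. cube p \<delta>)"
  proof
    fix z assume z: "z \<in> cube (a, b) R \<inter> full_popcorn_set"
    obtain x y where xy: "z = (x, y)" by (cases z)
    have x: "a \<le> x" "x \<le> a + R" using z by (auto simp: xy cube_prod)
    show "z \<in> (\<Union>p\<in>P \<union> ?T. cube p \<delta>)"
    proof (cases "0 \<le> y \<and> y \<le> 1 / K")
      case True
      with x have "z \<in> {a..a + R} \<times> {0..0 + 1 / K}" by (simp add: xy)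
      with P(3) show ?thesis by blast
    next
      case False
      with z assms(5) obtain p q :: nat where pq: "0 < q" "x = real p / real q" "y = 1 / real q"
        by (auto simp: xy full_popcorn_set_def)
      with False have "real q < K"
        using assms(5) by (auto simp: not_le field_simps)
      then have "q \<in> ?I" using pq(1) by (auto simp: le_nat_floor)
      moreover have "p \<in> ?F q" using x pq by (simp add: field_simps)
      ultimately have "z \<in> ?T" unfolding xy pq by (intro image_eqI[of _ _ "(q, p)"]) auto
      moreover have "z \<in> cube z \<delta>" using assms(1) by (simp add: xy cube_prod)
      ultimately show ?thesis by blast
    qed
  qed
  then have "covering_number \<delta> (cube (a, b) R \<inter> full_popcorn_set) \<le> card (P \<union> ?T)"
    using P(1) F(1) by (intro covering_number_le) auto
  also have "\<dots> \<le> card P + card ?T" by (rule card_Un_le)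
  finally show ?thesis using cardP cardT by linarith
qed

lemma assouad_exponent_full_popcorn:
  assumes "0 < \<theta>" "\<theta> \<le> 2 / 3"
  shows "assouad_exponent \<theta> full_popcorn_set ((4 / 3 - \<theta>) / (1 - \<theta>))"
  unfolding assouad_exponent_def
proof (intro exI[of _ 6] conjI allI impI)
  fix R :: real and x :: "real \<times> real" assume R: "0 < R \<and> R < 1"
  define \<delta> where "\<delta> = R powr (1 / \<theta>)"
  define K where "K = R powr (- 2 / (3 * \<theta>))"
  obtain a b where x: "x = (a, b)" by (cases x)
  have "\<delta> \<le> R powr 1" unfolding \<delta>_def
    using R assms by (intro powr_mono') auto
  then have 1: "\<delta> \<le> R" using R by simp
  have "R * K = R powr (1 + - 2 / (3 * \<theta>))"
    unfolding K_def powr_add using R by simp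
  \<comment> \<open>This is where \<theta> \<le> 2/3 enters: the cut height 1/K is then at most
    R.\<close>
  moreover have "1 + - 2 / (3 * \<theta>) \<le> 0" using assms by (simp add: field_simps)
  ultimately have 2: "1 \<le> R * K" using R powr_mono'[of "1 + - 2 / (3 * \<theta>)" 0 R] by simp
  have "\<delta> * K = R powr (1 / \<theta> + - 2 / (3 * \<theta>))"
    unfolding \<delta>_def K_def powr_add by simp
  moreover have "0 \<le> 1 / \<theta> + - 2 / (3 * \<theta>)" using assms by (simp add: field_simps)
  ultimately have 3: "\<delta> * K \<le> 1" using R powr_mono'[of 0 "1 / \<theta> + - 2 / (3 * \<theta>)" R] by simp
  have "\<delta>\<^sup>2 * K ^ 3 = R powr (2 * (1 / \<theta>) + 3 * (- 2 / (3 * \<theta>)))"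
    unfolding powr_add \<delta>_def K_def using R by (simp add: powr_power mult.commute)
  also have "2 * (1 / \<theta>) + 3 * (- 2 / (3 * \<theta>)) = 0" using assms by (simp add: field_simps)
  finally have 4: "\<delta>\<^sup>2 * K ^ 3 = 1" using R by simp
  have "real (covering_number \<delta> (cube x R \<inter> full_popcorn_set)) \<le> 6 * (R * K\<^sup>2)"
    unfolding x using R 1 2 3 4
    by (intro covering_number_full_popcorn_le) (auto simp: \<delta>_def K_def)
  also have "R * K\<^sup>2 = R powr (1 + 2 * (- 2 / (3 * \<theta>)))"
    unfolding powr_add K_def using R by (simp add: powr_power mult.commute)
  also have "1 + 2 * (- 2 / (3 * \<theta>)) = (1 - 1 / \<theta>) * ((4 / 3 - \<theta>) / (1 - \<theta>))"
    using assms by (simp add: field_simps)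
  finally show "real (covering_number (R powr (1 / \<theta>)) (cube x R \<inter> full_popcorn_set))
      \<le> 6 * R powr ((1 - 1 / \<theta>) * ((4 / 3 - \<theta>) / (1 - \<theta>)))"
    unfolding \<delta>_def .
qed simp

lemma popcorn_graph_subset: "popcorn_graph \<subseteq> full_popcorn_set"
proof
  fix z assume "z \<in> popcorn_graph"
  then obtain x where z: "z = (x, popcorn x)" "x \<in> {0..1}" by (auto simp: popcorn_graph_def)
  show "z \<in> full_popcorn_set"
  proof (cases "\<exists>p q :: nat. coprime p q \<and> 1 \<le> p \<and> p < q \<and> x = real p / real q")
    case True
    then obtain p q :: nat where pq: "coprime p q" "1 \<le> p" "p < q" "x = real p / real q" by blast
    then have "z = (real p / real q, 1 / real q)" by (simp add: z popcorn_fraction)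
    moreover have "0 < p" "0 < q" using pq by auto
    ultimately show ?thesis using pq(3) unfolding full_popcorn_set_def by blast
  next
    case False
    then have "popcorn x = 0" unfolding popcorn_def by (rule if_not_P)
    then show ?thesis using z by (simp add: full_popcorn_set_def)
  qed
qed

subsection \<open>Lower bound\<close>

text \<open>With \<delta> = Q^(-3/2) the large squares have side R = \<delta>^\<theta> = Q^(-a). At
  most 4 Q^(a + max 0 (a - 1)) of them tile the strip containing the points, and 264 = 66 *
  4.\<close>

lemma popcorn_exponent_inequality:
  fixes \<theta> s c :: real
  defines "a \<equiv> 3 / 2 * \<theta>"
  assumes "0 < \<theta>" "0 < c" "5 \<le> Q"
    and bound: "\<And>R x. 0 < R \<Longrightarrow> R < 1 \<Longrightarrow>
      real (covering_number (R powr (1 / \<theta>)) (cube x R \<inter> popcorn_graph)) \<le> c * R powr ((1 - 1 / \<theta>) * s)"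
  shows "(real Q)\<^sup>2 \<le> 264 * c * (log 2 (2 * real Q) + 1)\<^sup>2 *
           real Q powr (a + max 0 (a - 1) + 3 / 2 * (1 - \<theta>) * s)"
proof -
  let ?L = "log 2 (2 * real Q) + 1" and ?m = "max 0 (a - 1)" and ?X = "fraction_point ` middle_fractions Q"
  define R where "R = real Q powr (- a)"
  have Q: "1 < real Q" using assms(4) by simp
  have a: "0 < a" using assms(2) by (simp add: a_def)
  have R: "0 < R" "R < 1"
    using Q a powr_less_one[of "real Q" "- a"] by (auto simp: R_def)
  have \<delta>: "R powr (1 / \<theta>) = 1 / (real Q * sqrt (real Q))"
  proof -
    have "R powr (1 / \<theta>) = real Q powr (- (1 + 1 / 2))"
      using assms(2) by (simp add: R_def powr_powr a_def)
    also have "\<dots> = inverse (real Q powr 1 * real Q powr (1 / 2))"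
      by (simp only: powr_minus powr_add)
    also have "\<dots> = 1 / (real Q * sqrt (real Q))"
      using Q by (simp add: powr_half_sqrt inverse_eq_divide)
    finally show ?thesis .
  qed
  have N: "R powr ((1 - 1 / \<theta>) * s) = real Q powr (3 / 2 * (1 - \<theta>) * s)"
  proof -
    have "- a * ((1 - 1 / \<theta>) * s) = 3 / 2 * (1 - \<theta>) * s"
      using assms(2) by (simp add: a_def field_simps)
    then show ?thesis by (simp only: R_def powr_powr)
  qed
  obtain G where G: "finite G" "real (card G) \<le> (1 / R + 1) * ((1 / real Q) / R + 1)"
    "{0::real..1} \<times> {0..1 / real Q} \<subseteq> (\<Union>g\<in>G. cube g R)"
    using rectangle_cover[OF R(1), of 1 "1 / real Q" 0 0] by auto
  have inv: "1 / R = real Q powr a" by (simp add: R_def powr_minus divide_inverse)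
  have "1 / R + 1 \<le> 2 * real Q powr a"
    unfolding inv using ge_one_powr_ge_zero[of "real Q" a] Q a by simp
  \<comment> \<open>For a \<le> 1, that is \<theta> \<le> 2/3, the strip is no higher than an
    \<open>R\<close>-square and boundedly many rows suffice; otherwise about Q^(a - 1) rows are
    needed. This produces the two regimes.\<close>
  moreover have "(1 / real Q) / R + 1 \<le> 2 * real Q powr ?m"
  proof -
    have "(1 / real Q) / R = (1 / R) / real Q" by simp
    also have "\<dots> = real Q powr (a - 1)"
      unfolding inv using Q by (simp add: powr_diff)
    also have "\<dots> \<le> real Q powr ?m" using Q by (intro powr_mono) auto
    finally show ?thesis using ge_one_powr_ge_zero[of "real Q" ?m] Q by simp
  qed
  ultimately have "(1 / R + 1) * ((1 / real Q) / R + 1) \<le> (2 * real Q powr a) * (2 * real Q powr ?m)"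
    using R Q by (intro mult_mono) auto
  with G(2) have cardG: "real (card G) \<le> 4 * real Q powr (a + ?m)" by (simp add: powr_add)
  have "?X \<subseteq> {0..1} \<times> {0..1 / real Q}"
    using fraction_point_in_popcorn_graph(2)[of _ Q] assms(4) by (intro image_subsetI) simp
  from this G(3) have X2: "?X \<subseteq> (\<Union>g\<in>G. cube g R)" by (rule order_trans)
  have X1: "?X \<subseteq> popcorn_graph"
    using fraction_point_in_popcorn_graph(1)[of _ Q] assms(4) by (intro image_subsetI) simp
  have N: "real (covering_number (R powr (1 / \<theta>)) (cube g R \<inter> popcorn_graph))
      \<le> c * real Q powr (3 / 2 * (1 - \<theta>) * s)" for g
    using bound[OF R] unfolding N .
  have "0 < R powr (1 / \<theta>)" using R by simp
  from cover_of_cube_bounds[OF G(1) R(1) this X1 X2 N]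
  obtain P where P: "finite P" "real (card P) \<le> real (card G) * (c * real Q powr (3 / 2 * (1 - \<theta>) * s))"
    "?X \<subseteq> (\<Union>p\<in>P. cube p (R powr (1 / \<theta>)))"
    by blast
  have "(real Q)\<^sup>2 \<le> 66 * ?L\<^sup>2 * real (card P)"
    using P(1,3) unfolding \<delta> by (rule card_cover_middle_fractions_ge[OF assms(4)])
  also have "\<dots> \<le> 66 * ?L\<^sup>2 * (4 * real Q powr (a + ?m) * (c * real Q powr (3 / 2 * (1 - \<theta>) * s)))"
    using P(2) cardG assms(3)
    by (intro mult_left_mono order_trans[OF P(2)] mult_right_mono) auto
  also have "\<dots> = 264 * c * ?L\<^sup>2 * real Q powr (a + ?m + 3 / 2 * (1 - \<theta>) * s)"
    by (simp add: powr_add)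
  finally show ?thesis .
qed

text \<open>Let \<open>Q\<close> tend to infinity in the previous inequality: a deficit in the
  exponent would leave a positive power of \<open>Q\<close> bounded by a squared logarithm.\<close>

lemma assouad_exponent_popcorn_graph_ge:
  fixes \<theta> s :: real
  assumes "0 < \<theta>" "assouad_exponent \<theta> popcorn_graph s"
  shows "2 \<le> 3 / 2 * \<theta> + max 0 (3 / 2 * \<theta> - 1) + 3 / 2 * (1 - \<theta>) * s" (is "2 \<le> ?e")
proof (rule ccontr)
  assume "\<not> 2 \<le> ?e"
  then have e: "0 < 2 - ?e" by simp
  obtain c where c: "c > 0" "\<And>R x. 0 < R \<Longrightarrow> R < 1 \<Longrightarrow>
      real (covering_number (R powr (1 / \<theta>)) (cube x R \<inter> popcorn_graph)) \<le> c * R powr ((1 - 1 / \<theta>) * s)"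
    using assms(2) unfolding assouad_exponent_def by blast
  define d K where "d = 2 - ?e" and "K = 264 * c"
  have "\<forall>\<^sub>F n in sequentially. K * (log 2 (2 * real n) + 1)\<^sup>2 < real n powr d"
    using e c(1) unfolding d_def[symmetric] by real_asymp
  then have "\<forall>\<^sub>F n in sequentially. 5 \<le> n \<and> K * (log 2 (2 * real n) + 1)\<^sup>2 < real n powr d"
    using eventually_ge_at_top[of 5] by eventually_elim auto
  then obtain Q where Q: "5 \<le> Q" "K * (log 2 (2 * real Q) + 1)\<^sup>2 < real Q powr d"
    unfolding eventually_sequentially by blast
  have "real Q powr d * real Q powr ?e = (real Q)\<^sup>2"
    using Q(1) by (simp add: d_def flip: powr_add)
  also have "\<dots> \<le> K * (log 2 (2 * real Q) + 1)\<^sup>2 * real Q powr ?e"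
    unfolding K_def by (rule popcorn_exponent_inequality[OF assms(1) c(1) Q(1) c(2)])
  also have "\<dots> < real Q powr d * real Q powr ?e"
    using Q by (intro mult_strict_right_mono) auto
  finally show False by simp
qed

theorem theorem3p1:
  fixes \<theta> :: real
  assumes "0 < \<theta>" and "\<theta> < 1"
  shows "assouad_spectrum \<theta> popcorn_graph =
           (if \<theta> < 2/3 then (4/3 - \<theta>) / (1 - \<theta>) else 2) \<and>
         assouad_spectrum \<theta> full_popcorn_set =
           (if \<theta> < 2/3 then (4/3 - \<theta>) / (1 - \<theta>) else 2)"
proof -
  let ?d = "if \<theta> < 2/3 then (4/3 - \<theta>) / (1 - \<theta>) else 2"
  have nonneg: "0 \<le> ?d" using assms by auto
  \<comment> \<open>From \<theta> = 2/3 on, the ambient dimension 2 is the upper bound.\<close>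
  have full: "assouad_exponent \<theta> full_popcorn_set ?d"
    using assouad_exponent_full_popcorn[of \<theta>] assouad_exponent_two[of \<theta>] assms by simp
  have graph: "assouad_exponent \<theta> popcorn_graph ?d"
    by (rule assouad_exponent_mono[OF full popcorn_graph_subset])
  have lower: "?d \<le> s" if "assouad_exponent \<theta> popcorn_graph s" for s
  proof (cases "\<theta> < 2/3")
    case True
    with assouad_exponent_popcorn_graph_ge[OF assms(1) that] have "4 / 3 - \<theta> \<le> s * (1 - \<theta>)"
      by (simp add: max_def field_simps split: if_splits)
    with True assms show ?thesis by (simp add: pos_divide_le_eq)
  next
    case False
    \<comment> \<open>Now the maximum is 3\<theta>/2 - 1, so the inequality reads 3 (1 - \<theta>)
      \<le> (3/2) (1 - \<theta>) s.\<close>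
    with assouad_exponent_popcorn_graph_ge[OF assms(1) that] have "2 * (1 - \<theta>) \<le> s * (1 - \<theta>)"
      by (simp add: max_def field_simps split: if_splits)
    then have "2 \<le> s" by (rule mult_right_le_imp_le) (use assms in simp)
    with False show ?thesis by simp
  qed
  have lower_full: "?d \<le> s" if "assouad_exponent \<theta> full_popcorn_set s" for s
    using lower assouad_exponent_mono[OF that popcorn_graph_subset] by blast
  show ?thesis
  proof
    show "assouad_spectrum \<theta> popcorn_graph = ?d"
      using nonneg graph lower by (rule assouad_spectrum_eqI)
    show "assouad_spectrum \<theta> full_popcorn_set = ?d"
      using nonneg full lower_full by (rule assouad_spectrum_eqI)
  qed
qed

end
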